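(* Let $l\ge1$. For each finite word $w=w_1\cdots w_n$ over $\mathbb{N}=\{0,1,2,\dots\}$ (including the empty word, of weight $1$) define its weight $\Psi(w)=\prod_{i=1}^n\mathrm{wt}_i(w)$, where, writing $w_i=ul+m$ with $u\ge0$ and $0\le m\le l-1$: (a) if $i$ is a decrease of $w$: $\mathrm{wt}_i(w)=tY_{u-1}$ if $m=0$, and $\mathrm{wt}_i(w)=s_mY_u$ if $m\ge1$; (b) if $i$ is an increase but not a record of $w$: $\mathrm{wt}_i(w)=Y_u$ if $m=0$, and $s_mY_u$ if $m\ge1$; (c) if $i$ is an increase and a record of $w$: $\mathrm{wt}_i(w)=r_0Y_u$ if $m=0$, and $r_ms_mY_u$ if $m\ge1$. Then, as formal power series in $Y_0,Y_1,\dots$ with coefficients in $\mathbb{Q}(t,r_0,\dots,r_{l-1},s_1,\dots,s_{l-1})$, $$\lim_{r\rightarrow\infty}\sum_{w\in[0,r]^*}\Psi(w)=\frac{H(r_0Y)(1-t)\prod_{m=1}^{l-1}E(-s_mY)H(r_ms_mY)}{\bigl(1+\sum_{m=1}^{l-1}s_m\bigr)H(tY)-\bigl(t+\sum_{m=1}^{l-1}s_m\bigr)H(Y)},$$ where $[0,r]^*$ is the set of finite words over $\{0,1,\dots,r\}$, $H(aY)=\prod_{i\geq0}(1-aY_i)^{-1}$ and $E(aY)=\prod_{i\geq0}(1+aY_i)$.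
   Context: For a word $w=w_1\cdots w_n$ over $\mathbb{N}$: an index $i\in[n-1]$ is a decrease of $w$ if $w_i=w_{i+1}=\cdots=w_j>w_{j+1}$ for some $j$ with $i\le j\le n-1$; an index $i\in[n]$ is an increase if it is not a decrease (so $n$ is always an increase); an index $i$ is a record if $w_i\ge w_j$ for all $1\le j\le i-1$. Note that if $i$ is a decrease then $w_i\ge1$, so in case (a) with $m=0$ one has $u\ge1$. *)

theory Defs
  imports "HOL-Library.Poly_Mapping"
begin

(* Formal power series in the countably many commuting variables Y_0, Y_1, ...
   with coefficients in 'a: a function from monomials (finitely supported
   exponent vectors alpha, Y^alpha = prod_i Y_i^(alpha i)) to coefficients. *)
type_synonym 'a mps = "(nat \<Rightarrow>\<^sub>0 nat) \<Rightarrow> 'a"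

definition mps_monom :: "'a::zero \<Rightarrow> (nat \<Rightarrow>\<^sub>0 nat) \<Rightarrow> 'a mps" where
  "mps_monom c \<beta> = (\<lambda>\<alpha>. if \<alpha> = \<beta> then c else 0)"

definition mps_const :: "'a::zero \<Rightarrow> 'a mps" where
  "mps_const c = mps_monom c 0"

definition Yv :: "nat \<Rightarrow> (nat \<Rightarrow>\<^sub>0 nat)" where
  "Yv i = Poly_Mapping.single i 1"

definition mps_add :: "'a::plus mps \<Rightarrow> 'a mps \<Rightarrow> 'a mps" where
  "mps_add f g = (\<lambda>\<alpha>. f \<alpha> + g \<alpha>)"

definition mps_diff :: "'a::minus mps \<Rightarrow> 'a mps \<Rightarrow> 'a mps" where
  "mps_diff f g = (\<lambda>\<alpha>. f \<alpha> - g \<alpha>)"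

definition mps_scale :: "'a::times \<Rightarrow> 'a mps \<Rightarrow> 'a mps" where
  "mps_scale c f = (\<lambda>\<alpha>. c * f \<alpha>)"

(* Cauchy product; the index set {(beta,gamma). beta+gamma=alpha} is finite *)
definition mps_mult :: "'a::comm_semiring_1 mps \<Rightarrow> 'a mps \<Rightarrow> 'a mps" where
  "mps_mult f g = (\<lambda>\<alpha>. \<Sum>(\<beta>,\<gamma>)\<in>{(\<beta>,\<gamma>). \<beta> + \<gamma> = \<alpha>}. f \<beta> * g \<gamma>)"

fun mps_prod :: "(nat \<Rightarrow> 'a::comm_semiring_1 mps) \<Rightarrow> nat \<Rightarrow> 'a mps" where
  "mps_prod F 0 = mps_const 1"
| "mps_prod F (Suc n) = mps_mult (mps_prod F n) (F n)"

(* multiplicative inverse (exists iff the constant term is invertible) *)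
definition mps_inverse :: "'a::comm_semiring_1 mps \<Rightarrow> 'a mps" where
  "mps_inverse f = (THE g. mps_mult f g = mps_const 1)"

definition mps_divide :: "'a::comm_semiring_1 mps \<Rightarrow> 'a mps \<Rightarrow> 'a mps" where
  "mps_divide f g = mps_mult f (mps_inverse g)"

definition mps_tendsto :: "(nat \<Rightarrow> 'a mps) \<Rightarrow> 'a mps \<Rightarrow> bool" where
  "mps_tendsto S L \<longleftrightarrow> (\<forall>\<alpha>. eventually (\<lambda>N. S N \<alpha> = L \<alpha>) sequentially)"

definition mps_lim :: "(nat \<Rightarrow> 'a mps) \<Rightarrow> 'a mps" where
  "mps_lim S = (THE L. mps_tendsto S L)"

(* sum of a (possibly infinite) family of series, each coefficient receiving
   only finitely many nonzero contributions (summable in the formal topology) *)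
definition mps_sum :: "('b \<Rightarrow> 'a::comm_monoid_add mps) \<Rightarrow> 'b set \<Rightarrow> 'a mps" where
  "mps_sum F W = (\<lambda>\<alpha>. \<Sum>w\<in>{w\<in>W. F w \<alpha> \<noteq> 0}. F w \<alpha>)"

definition H_ser :: "'a::comm_ring_1 \<Rightarrow> 'a mps" where
  "H_ser a = mps_lim (\<lambda>N. mps_prod
     (\<lambda>i. mps_inverse (mps_diff (mps_const 1) (mps_monom a (Yv i)))) N)"

definition E_ser :: "'a::comm_ring_1 \<Rightarrow> 'a mps" where
  "E_ser a = mps_lim (\<lambda>N. mps_prod
     (\<lambda>i. mps_add (mps_const 1) (mps_monom a (Yv i))) N)"

(* Words are lists; positions are 0-indexed here: list position i corresponds
   to the paper's index i+1. *)
definition is_decrease :: "nat list \<Rightarrow> nat \<Rightarrow> bool" where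
  "is_decrease w i \<longleftrightarrow> i + 1 < length w \<and>
     (\<exists>j. i \<le> j \<and> j + 1 < length w \<and> (\<forall>k. i \<le> k \<and> k \<le> j \<longrightarrow> w ! k = w ! i)
          \<and> w ! j > w ! (j + 1))"

definition is_increase :: "nat list \<Rightarrow> nat \<Rightarrow> bool" where
  "is_increase w i \<longleftrightarrow> i < length w \<and> \<not> is_decrease w i"

definition is_record :: "nat list \<Rightarrow> nat \<Rightarrow> bool" where
  "is_record w i \<longleftrightarrow> i < length w \<and> (\<forall>j<i. w ! j \<le> w ! i)"

definition wt :: "nat \<Rightarrow> 'a::comm_ring_1 \<Rightarrow> (nat \<Rightarrow> 'a) \<Rightarrow> (nat \<Rightarrow> 'a)
                   \<Rightarrow> nat list \<Rightarrow> nat \<Rightarrow> 'a mps" where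
  "wt l t rr s w i =
    (let u = w ! i div l; m = w ! i mod l in
     if is_decrease w i then
       (if m = 0 then mps_monom t (Yv (u - 1)) else mps_monom (s m) (Yv u))
     else if \<not> is_record w i then
       (if m = 0 then mps_monom 1 (Yv u) else mps_monom (s m) (Yv u))
     else
       (if m = 0 then mps_monom (rr 0) (Yv u) else mps_monom (rr m * s m) (Yv u)))"

definition Psi :: "nat \<Rightarrow> 'a::comm_ring_1 \<Rightarrow> (nat \<Rightarrow> 'a) \<Rightarrow> (nat \<Rightarrow> 'a)
                   \<Rightarrow> nat list \<Rightarrow> 'a mps" where
  "Psi l t rr s w = mps_prod (wt l t rr s w) (length w)"

end

theory Submission
  imports Defs
begin

text \<open>Cut a word over \<open>{0..N}\<close> at its occurrences of the maximal letter \<open>N\<close>. Every such letter is a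
  record, it ends all records to its right among smaller letters, and it is a decrease unless it is
  followed only by copies of itself. Writing \<open>x\<close>, \<open>y\<close>, \<open>z\<close> for the three kinds of weights, \<open>F\<^sub>N\<close> for the
  series of words over \<open>{0..<N}\<close>, and \<open>B\<^sub>N\<close> for the same series with \<open>z\<close> replaced by \<open>y\<close>, this gives
  \<open>F\<^sub>N\<^sub>+\<^sub>1 = F\<^sub>N (1 - x\<^sub>N) / ((1 - z\<^sub>N) (1 - x\<^sub>N B\<^sub>N))\<close>. The reciprocal of \<open>B\<^sub>N\<close> therefore satisfies a linear
  recursion, with solution \<open>F\<^sub>N D\<^sub>N = (\<Prod>a<N. (1 - x\<^sub>a) / (1 - z\<^sub>a))\<close> where
  \<open>D\<^sub>N = 1 - (\<Sum>a<N. x\<^sub>a (\<Prod>b<a. (1 - x\<^sub>b) / (1 - y\<^sub>b)))\<close>. For the weights of the theorem and \<open>N = Ul\<close> the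
  products nearly cancel and the sum telescopes; then let \<open>U\<close> tend to infinity. The case where all
  \<open>r\<^sub>m\<close> equal 1 shows that the denominator of the formula is invertible.\<close>

subsection \<open>The ring of formal power series in countably many variables\<close>

abbreviation decomps :: "(nat \<Rightarrow>\<^sub>0 nat) \<Rightarrow> ((nat \<Rightarrow>\<^sub>0 nat) \<times> (nat \<Rightarrow>\<^sub>0 nat)) set" where
  "decomps \<alpha> \<equiv> {(\<beta>, \<gamma>). \<beta> + \<gamma> = \<alpha>}"

lemma finite_decomps: "finite (decomps \<alpha>)"
proof -
  let ?B = "{\<beta> :: nat \<Rightarrow>\<^sub>0 nat. \<forall>i. Poly_Mapping.lookup \<beta> i \<le> Poly_Mapping.lookup \<alpha> i}"
  let ?V = "\<Union>i\<in>Poly_Mapping.keys \<alpha>. {..Poly_Mapping.lookup \<alpha> i}"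
  have "finite (Poly_Mapping.lookup ` ?B)"
  proof (rule finite_subset)
    show "Poly_Mapping.lookup ` ?B \<subseteq> {f. \<forall>i.
        (i \<in> Poly_Mapping.keys \<alpha> \<longrightarrow> f i \<in> ?V) \<and> (i \<notin> Poly_Mapping.keys \<alpha> \<longrightarrow> f i = 0)}"
      by (auto simp: in_keys_iff) (metis le_zero_eq)
    show "finite \<dots>"
      by (rule finite_set_of_finite_funs) auto
  qed
  then have "finite ?B"
    by (rule finite_imageD) (simp add: inj_on_def poly_mapping.lookup_inject)
  then have "finite (?B \<times> ?B)"
    by (intro finite_cartesian_product)
  moreover have "decomps \<alpha> \<subseteq> ?B \<times> ?B"
    by (auto simp: lookup_add)
  ultimately show ?thesis
    by (rule rev_finite_subset)
qed

text \<open>A type of its own carries the Cauchy product as the multiplication of a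
  \<open>comm_ring_1\<close>, so that ring laws, powers and finite products are available.\<close>

typedef 'a mpser = "UNIV :: 'a mps set"
  morphisms coeff Mpser by simp

lemma coeff_Mpser [simp]: "coeff (Mpser f) = f"
  by (simp add: Mpser_inverse)

lemma mpser_eqI: "(\<And>\<alpha>. coeff f \<alpha> = coeff g \<alpha>) \<Longrightarrow> f = g"
  by (metis coeff_inject ext)

instantiation mpser :: (comm_ring_1) comm_ring_1
begin

definition "0 = Mpser (\<lambda>_. 0)"
definition "1 = Mpser (mps_const 1)"
definition "f + g = Mpser (mps_add (coeff f) (coeff g))"
definition "f - g = Mpser (mps_diff (coeff f) (coeff g))"
definition "- f = Mpser (\<lambda>\<alpha>. - coeff f \<alpha>)"
definition "f * g = Mpser (mps_mult (coeff f) (coeff g))"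

lemma coeff_mult: "coeff (f * g) \<alpha> = (\<Sum>(\<beta>, \<gamma>)\<in>decomps \<alpha>. coeff f \<beta> * coeff g \<gamma>)"
  for f g :: "'a mpser"
  by (simp add: times_mpser_def mps_mult_def)

instance
proof
  fix f g h :: "'a mpser"
  show "f * g = g * f"
    by (intro mpser_eqI, unfold coeff_mult)
      (rule sum.reindex_bij_witness[of _ prod.swap prod.swap], auto simp: mult.commute add.commute)
  show "f * g * h = f * (g * h)"
  proof (rule mpser_eqI)
    fix \<alpha>
    have "coeff (f * g * h) \<alpha> = (\<Sum>p\<in>decomps \<alpha>. \<Sum>q\<in>decomps (fst p).
        coeff f (fst q) * coeff g (snd q) * coeff h (snd p))"
      by (simp add: coeff_mult sum_distrib_right split_def)
    also have "\<dots> = (\<Sum>(p, q)\<in>Sigma (decomps \<alpha>) (\<lambda>p. decomps (fst p)).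
        coeff f (fst q) * coeff g (snd q) * coeff h (snd p))"
      by (rule sum.Sigma) (auto intro: finite_decomps)
    also have "\<dots> = (\<Sum>(p, q)\<in>Sigma (decomps \<alpha>) (\<lambda>p. decomps (snd p)).
        coeff f (fst p) * (coeff g (fst q) * coeff h (snd q)))"
      by (rule sum.reindex_bij_witness[of _ "\<lambda>((\<beta>, q), (\<gamma>, \<delta>)). ((\<beta> + \<gamma>, \<delta>), (\<beta>, \<gamma>))"
            "\<lambda>((q, \<delta>), (\<beta>, \<gamma>)). ((\<beta>, \<gamma> + \<delta>), (\<gamma>, \<delta>))"]) (auto simp: mult.assoc add.assoc)
    also have "\<dots> = (\<Sum>p\<in>decomps \<alpha>. \<Sum>q\<in>decomps (snd p).
        coeff f (fst p) * (coeff g (fst q) * coeff h (snd q)))"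
      by (rule sum.Sigma[symmetric]) (auto intro: finite_decomps)
    also have "\<dots> = coeff (f * (g * h)) \<alpha>"
      by (simp add: coeff_mult sum_distrib_left split_def)
    finally show "coeff (f * g * h) \<alpha> = coeff (f * (g * h)) \<alpha>" .
  qed
  show "1 * f = f"
  proof (rule mpser_eqI)
    fix \<alpha>
    have "coeff (1 * f) \<alpha> = (\<Sum>p\<in>{(0, \<alpha>)}. coeff 1 (fst p) * coeff f (snd p))"
      unfolding coeff_mult split_def
      by (rule sum.mono_neutral_right)
        (use finite_decomps in \<open>auto simp: split_def one_mpser_def mps_const_def mps_monom_def\<close>)
    then show "coeff (1 * f) \<alpha> = coeff f \<alpha>"
      by (simp add: one_mpser_def mps_const_def mps_monom_def)
  qed
  show "(f + g) * h = f * h + g * h"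
    by (rule mpser_eqI)
      (simp add: coeff_mult plus_mpser_def mps_add_def split_def algebra_simps sum.distrib)
  show "(0 :: 'a mpser) \<noteq> 1"
    by (metis coeff_Mpser mps_const_def mps_monom_def one_mpser_def zero_mpser_def zero_neq_one)
qed (rule mpser_eqI; simp add: zero_mpser_def plus_mpser_def minus_mpser_def uminus_mpser_def
      mps_add_def mps_diff_def add_ac)+

end

lemma coeff_0 [simp]: "coeff 0 \<alpha> = 0"
  and coeff_add [simp]: "coeff (f + g) \<alpha> = coeff f \<alpha> + coeff g \<alpha>"
  and coeff_diff [simp]: "coeff (f - g) \<alpha> = coeff f \<alpha> - coeff g \<alpha>"
  and coeff_uminus [simp]: "coeff (- f) \<alpha> = - coeff f \<alpha>"
  and coeff_1: "coeff 1 \<alpha> = (if \<alpha> = 0 then 1 else 0)"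
  by (simp_all add: zero_mpser_def one_mpser_def plus_mpser_def minus_mpser_def
      uminus_mpser_def mps_add_def mps_diff_def mps_const_def mps_monom_def)

lemma coeff_mult_nonzeroE:
  assumes "coeff (f * g) \<alpha> \<noteq> 0"
  obtains \<beta> \<gamma> where "\<beta> + \<gamma> = \<alpha>" "coeff f \<beta> \<noteq> 0" "coeff g \<gamma> \<noteq> 0"
proof -
  from assms obtain p where "p \<in> decomps \<alpha>" "coeff f (fst p) * coeff g (snd p) \<noteq> 0"
    unfolding coeff_mult split_def by (rule sum.not_neutral_contains_not_neutral)
  then show ?thesis
    by (intro that[of "fst p" "snd p"]) auto
qed

definition const :: "'a::zero \<Rightarrow> 'a mpser" where
  "const c = Mpser (mps_const c)"

definition var :: "'a::zero \<Rightarrow> nat \<Rightarrow> 'a mpser" where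
  "var c i = Mpser (mps_monom c (Yv i))"

lemma coeff_var: "coeff (var c i) \<alpha> = (if \<alpha> = Yv i then c else 0)"
  by (simp add: var_def mps_monom_def)

lemma coeff_const_mult: "coeff (const c * f) \<alpha> = c * coeff f \<alpha>"
proof -
  have "coeff (const c * f) \<alpha> = (\<Sum>p\<in>{(0, \<alpha>)}. coeff (const c) (fst p) * coeff f (snd p))"
    unfolding coeff_mult split_def
    by (rule sum.mono_neutral_right)
      (use finite_decomps in \<open>auto simp: split_def const_def mps_const_def mps_monom_def\<close>)
  then show ?thesis
    by (simp add: const_def mps_const_def mps_monom_def)
qed

lemma coeff_scale: "mps_scale c (coeff f) = coeff (const c * f)"
  by (simp add: fun_eq_iff mps_scale_def coeff_const_mult)

lemma var_eq_const_mult: "var c i = const c * var 1 i"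
  by (rule mpser_eqI) (simp add: coeff_const_mult coeff_var)

lemma coeff_const: "coeff (const c) \<alpha> = (if \<alpha> = 0 then c else 0)"
  by (simp add: const_def mps_const_def mps_monom_def)

lemma const_1 [simp]: "const 1 = (1 :: 'a::comm_ring_1 mpser)"
  and const_add: "const (c + d) = (const c + const d :: 'a mpser)"
  and const_diff: "const (c - d) = (const c - const d :: 'a mpser)"
  and const_mult: "const (c * d) = (const c * const d :: 'a mpser)"
  by (rule mpser_eqI; simp add: coeff_const coeff_1 coeff_const_mult)+

lemma const_0 [simp]: "const 0 = (0 :: 'a::comm_ring_1 mpser)"
  by (rule mpser_eqI) (simp add: coeff_const)

lemma const_sum: "const (\<Sum>i\<in>I. c i) = (\<Sum>i\<in>I. const (c i :: 'a::comm_ring_1))"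
  by (induction I rule: infinite_finite_induct) (auto simp: const_add)

lemma mps_diff_coeff: "mps_diff (coeff f) (coeff g) = coeff (f - g)"
  and mps_mult_coeff: "mps_mult (coeff f) (coeff g) = coeff (f * g)"
  and mps_const_1: "mps_const 1 = coeff 1"
  by (simp_all add: minus_mpser_def times_mpser_def one_mpser_def)

lemma mps_prod_coeff: "mps_prod (\<lambda>i. coeff (f i)) n = coeff (\<Prod>i<n. f i)"
  by (induction n) (simp_all add: mps_mult_coeff mps_const_1)

text \<open>Inverses in a commutative ring are unique, so one exhibited inverse determines the
  definite description in \<open>mps_inverse\<close>.\<close>

lemma mps_inverse_coeff:
  assumes "f * g = 1"
  shows "mps_inverse (coeff f) = coeff g"
  unfolding mps_inverse_def
proof (rule the_equality)
  show "mps_mult (coeff f) (coeff g) = mps_const 1"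
    using assms by (simp add: mps_mult_coeff mps_const_1)
next
  fix h assume "mps_mult (coeff f) h = mps_const 1"
  then have "f * Mpser h = 1"
    by (simp add: times_mpser_def one_mpser_def)
  then have "Mpser h = g"
    using assms by (metis mult.assoc mult.commute mult_1)
  then show "h = coeff g"
    by (metis coeff_Mpser)
qed

subsection \<open>Homogeneous series\<close>

definition mdeg :: "(nat \<Rightarrow>\<^sub>0 nat) \<Rightarrow> nat" where
  "mdeg \<alpha> = Sum_any (Poly_Mapping.lookup \<alpha>)"

lemma mdeg_add: "mdeg (\<alpha> + \<beta>) = mdeg \<alpha> + mdeg \<beta>"
  by (simp add: mdeg_def lookup_add Sum_any.distrib)

lemma mdeg_0 [simp]: "mdeg 0 = 0"
  by (simp add: mdeg_def)

lemma mdeg_Yv [simp]: "mdeg (Yv i) = 1"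
  by (simp add: mdeg_def Yv_def lookup_single when_def)

text \<open>Degrees count letters: the weight of a word of length n will be homogeneous of degree n,
  so over a finite alphabet each monomial meets finitely many words.\<close>

definition homog :: "nat \<Rightarrow> 'a::zero mpser \<Rightarrow> bool" where
  "homog n f \<longleftrightarrow> (\<forall>\<alpha>. coeff f \<alpha> \<noteq> 0 \<longrightarrow> mdeg \<alpha> = n)"

lemma homog_0 [simp]: "homog n (0 :: 'a::comm_ring_1 mpser)"
  by (simp add: homog_def)

lemma homog_1 [simp]: "homog 0 (1 :: 'a::comm_ring_1 mpser)"
  by (simp add: homog_def coeff_1)

lemma homog_var [simp]: "homog (Suc 0) (var c i)"
  by (simp add: homog_def coeff_var)

lemma homog_diff:
  assumes "homog n f" "homog n g"
  shows "homog n (f - g)"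
  unfolding homog_def
proof (intro allI impI)
  fix \<alpha> assume "coeff (f - g) \<alpha> \<noteq> 0"
  then have "coeff f \<alpha> \<noteq> 0 \<or> coeff g \<alpha> \<noteq> 0"
    by auto
  then show "mdeg \<alpha> = n"
    using assms by (auto simp: homog_def)
qed

lemma homog_mult: "homog m f \<Longrightarrow> homog n g \<Longrightarrow> homog (m + n) (f * g)"
  unfolding homog_def by (auto elim!: coeff_mult_nonzeroE simp: mdeg_add)

lemma homog_power: "homog (Suc 0) f \<Longrightarrow> homog n (f ^ n)"
  by (induction n) (auto dest: homog_mult[of "Suc 0" f])

subsection \<open>Formally summable families\<close>

text \<open>A sum over an infinite set is 0 by default; this condition keeps that default of
  \<open>mps_sum\<close> out of the laws for \<open>msum\<close>.\<close>

definition fsummable :: "('b \<Rightarrow> 'a::zero mpser) \<Rightarrow> 'b set \<Rightarrow> bool" where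
  "fsummable F A \<longleftrightarrow> (\<forall>\<alpha>. finite {w \<in> A. coeff (F w) \<alpha> \<noteq> 0})"

definition msum :: "('b \<Rightarrow> 'a::comm_ring_1 mpser) \<Rightarrow> 'b set \<Rightarrow> 'a mpser" where
  "msum F A = Mpser (mps_sum (\<lambda>w. coeff (F w)) A)"

lemma coeff_msum: "coeff (msum F A) \<alpha> = (\<Sum>w\<in>{w \<in> A. coeff (F w) \<alpha> \<noteq> 0}. coeff (F w) \<alpha>)"
  by (simp add: msum_def mps_sum_def)

lemma coeff_msum_superset:
  assumes "finite S" "S \<subseteq> A" "\<And>w. w \<in> A - S \<Longrightarrow> coeff (F w) \<alpha> = 0"
  shows "coeff (msum F A) \<alpha> = (\<Sum>w\<in>S. coeff (F w) \<alpha>)"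
  unfolding coeff_msum by (rule sum.mono_neutral_left) (use assms in auto)

lemma msum_cong: "A = B \<Longrightarrow> (\<And>w. w \<in> B \<Longrightarrow> F w = G w) \<Longrightarrow> msum F A = msum G B"
  by (intro mpser_eqI, unfold coeff_msum) (rule sum.cong, auto)

lemma msum_reindex: "inj_on h A \<Longrightarrow> msum F (h ` A) = msum (\<lambda>w. F (h w)) A"
  by (intro mpser_eqI, unfold coeff_msum)
    (rule sum.reindex_cong[of h], auto simp: inj_on_def)

lemma msum_neutral:
  assumes "A \<subseteq> B" "\<And>w. w \<in> B - A \<Longrightarrow> F w = 0"
  shows "msum F B = msum F A"
proof (rule mpser_eqI)
  fix \<alpha>
  have "w \<in> A" if "w \<in> B" "coeff (F w) \<alpha> \<noteq> 0" for w
    by (rule ccontr) (use assms(2)[of w] that in simp)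
  then have "{w \<in> B. coeff (F w) \<alpha> \<noteq> 0} = {w \<in> A. coeff (F w) \<alpha> \<noteq> 0}"
    using assms(1) by auto
  then show "coeff (msum F B) \<alpha> = coeff (msum F A) \<alpha>"
    by (simp add: coeff_msum)
qed

lemma fsummable_homog:
  assumes "\<And>n. finite {w \<in> A. d w = n}" "\<And>w. w \<in> A \<Longrightarrow> homog (d w) (F w)"
  shows "fsummable F A"
  unfolding fsummable_def
proof
  fix \<alpha>
  show "finite {w \<in> A. coeff (F w) \<alpha> \<noteq> 0}"
    by (rule finite_subset[OF _ assms(1)[of "mdeg \<alpha>"]]) (use assms(2) in \<open>auto simp: homog_def\<close>)
qed

lemma msum_add:
  assumes "fsummable F A" "fsummable G A"
  shows "msum (\<lambda>w. F w + G w) A = msum F A + msum G A"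
proof (rule mpser_eqI)
  fix \<alpha>
  let ?S = "{w \<in> A. coeff (F w) \<alpha> \<noteq> 0} \<union> {w \<in> A. coeff (G w) \<alpha> \<noteq> 0}"
  have fin: "finite ?S"
    using assms by (simp add: fsummable_def)
  have *: "coeff (msum H A) \<alpha> = (\<Sum>w\<in>?S. coeff (H w) \<alpha>)"
    if "\<And>w. w \<in> A - ?S \<Longrightarrow> coeff (H w) \<alpha> = 0" for H :: "'a \<Rightarrow> 'b mpser"
    by (rule coeff_msum_superset) (use fin that in auto)
  show "coeff (msum (\<lambda>w. F w + G w) A) \<alpha> = coeff (msum F A + msum G A) \<alpha>"
    by (subst coeff_add, (subst *, force)+) (simp add: sum.distrib)
qed

lemma msum_Un_disjoint:
  assumes "fsummable F (A \<union> B)" "A \<inter> B = {}"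
  shows "msum F (A \<union> B) = msum F A + msum F B"
proof (rule mpser_eqI)
  fix \<alpha>
  have "{w \<in> A \<union> B. coeff (F w) \<alpha> \<noteq> 0} =
      {w \<in> A. coeff (F w) \<alpha> \<noteq> 0} \<union> {w \<in> B. coeff (F w) \<alpha> \<noteq> 0}"
    by auto
  moreover have "finite {w \<in> A \<union> B. coeff (F w) \<alpha> \<noteq> 0}"
    using assms(1) by (simp add: fsummable_def)
  ultimately show "coeff (msum F (A \<union> B)) \<alpha> = coeff (msum F A + msum F B) \<alpha>"
    using assms(2) by (auto simp: coeff_msum intro!: sum.union_disjoint)
qed

lemma msum_mult:
  assumes "fsummable F A" "fsummable G B"
  shows "msum F A * msum G B = msum (\<lambda>(u, v). F u * G v) (A \<times> B)"
proof (rule mpser_eqI)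
  fix \<alpha>
  \<comment> \<open>At a fixed \<alpha> there are finitely many decompositions, and each meets
    finitely many u and v. So the finite rectangle \<open>A0 \<times> B0\<close> carries all
    contributions, and the sums can be exchanged there.\<close>
  define A0 where "A0 = (\<Union>p\<in>decomps \<alpha>. {u \<in> A. coeff (F u) (fst p) \<noteq> 0})"
  define B0 where "B0 = (\<Union>p\<in>decomps \<alpha>. {v \<in> B. coeff (G v) (snd p) \<noteq> 0})"
  have fin: "finite A0" "finite B0"
    using assms finite_decomps by (auto simp: A0_def B0_def fsummable_def)
  have "coeff (msum F A * msum G B) \<alpha> =
      (\<Sum>p\<in>decomps \<alpha>. (\<Sum>u\<in>A0. coeff (F u) (fst p)) * (\<Sum>v\<in>B0. coeff (G v) (snd p)))"
    unfolding coeff_mult split_def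
  proof (rule sum.cong[OF refl], rule arg_cong2[of _ _ _ _ "(*)"])
    fix p assume p: "p \<in> {p. fst p + snd p = \<alpha>}"
    show "coeff (msum F A) (fst p) = (\<Sum>u\<in>A0. coeff (F u) (fst p))"
      by (rule coeff_msum_superset) (use fin p in \<open>auto simp: A0_def split_def\<close>)
    show "coeff (msum G B) (snd p) = (\<Sum>v\<in>B0. coeff (G v) (snd p))"
      by (rule coeff_msum_superset) (use fin p in \<open>auto simp: B0_def split_def\<close>)
  qed
  also have "\<dots> = (\<Sum>p\<in>decomps \<alpha>. \<Sum>(u, v)\<in>A0 \<times> B0. coeff (F u) (fst p) * coeff (G v) (snd p))"
    by (simp add: sum_product sum.cartesian_product)
  also have "\<dots> = (\<Sum>(u, v)\<in>A0 \<times> B0. coeff (F u * G v) \<alpha>)"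
    by (subst sum.swap) (simp add: coeff_mult split_def)
  also have "\<dots> = (\<Sum>q\<in>A0 \<times> B0. coeff (case q of (u, v) \<Rightarrow> F u * G v) \<alpha>)"
    by (simp add: split_def)
  also have "\<dots> = coeff (msum (\<lambda>(u, v). F u * G v) (A \<times> B)) \<alpha>"
  proof (rule coeff_msum_superset[symmetric])
    show "finite (A0 \<times> B0)" using fin by simp
    show "A0 \<times> B0 \<subseteq> A \<times> B" by (auto simp: A0_def B0_def)
    fix q assume q: "q \<in> A \<times> B - A0 \<times> B0"
    obtain u v where [simp]: "q = (u, v)" by (cases q)
    have "coeff (F u * G v) \<alpha> = 0"
    proof (rule ccontr)
      assume "coeff (F u * G v) \<alpha> \<noteq> 0"
      then obtain \<beta> \<gamma> where "\<beta> + \<gamma> = \<alpha>" "coeff (F u) \<beta> \<noteq> 0" "coeff (G v) \<gamma> \<noteq> 0"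
        by (rule coeff_mult_nonzeroE)
      then have "u \<in> A0 \<and> v \<in> B0"
        using q by (force simp: A0_def B0_def)
      then show False using q by simp
    qed
    then show "coeff (case q of (u, v) \<Rightarrow> F u * G v) \<alpha> = 0" by simp
  qed
  finally show "coeff (msum F A * msum G B) \<alpha> = coeff (msum (\<lambda>(u, v). F u * G v) (A \<times> B)) \<alpha>" .
qed

lemma msum_singleton [simp]: "msum F {w} = F w"
  by (rule mpser_eqI) (subst coeff_msum_superset[of "{w}"], auto)

lemma msum_const_mult:
  assumes "fsummable F A"
  shows "msum (\<lambda>w. c * F w) A = c * msum F A"
proof -
  have "c * msum F A = msum (\<lambda>(u, v). c * F v) ({()} \<times> A)"
    using msum_mult[OF _ assms, of "\<lambda>_. c" "{()}"] by (simp add: fsummable_def)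
  also have "{()} \<times> A = Pair () ` A"
    by auto
  also have "msum (\<lambda>(u, v). c * F v) (Pair () ` A) = msum (\<lambda>w. c * F w) A"
    by (subst msum_reindex) (simp_all add: inj_on_def)
  finally show ?thesis ..
qed

definition geo :: "'a::comm_ring_1 mpser \<Rightarrow> 'a mpser" where
  "geo z = msum (\<lambda>k. z ^ k) UNIV"

lemma fsummable_power: "homog (Suc 0) z \<Longrightarrow> fsummable (\<lambda>k. z ^ k) (A :: nat set)"
  by (rule fsummable_homog[where d = id]) (auto simp: homog_power)

lemma geo_unfold:
  assumes "homog (Suc 0) z"
  shows "geo z = 1 + z * geo z"
proof -
  have "geo z = msum (\<lambda>k. z ^ k) ({0} \<union> range Suc)"
    unfolding geo_def by (rule msum_cong) (auto simp: image_iff, metis not0_implies_Suc)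
  also have "\<dots> = 1 + msum (\<lambda>k. z ^ k) (range Suc)"
    by (subst msum_Un_disjoint) (auto intro: fsummable_power assms)
  also have "msum (\<lambda>k. z ^ k) (range Suc) = z * geo z"
    by (simp add: msum_reindex msum_const_mult fsummable_power assms geo_def)
  finally show ?thesis .
qed

lemma geo_inverse: "homog (Suc 0) z \<Longrightarrow> (1 - z) * geo z = 1"
  using geo_unfold[of z] by (simp add: algebra_simps)

subsection \<open>Formal limits\<close>

abbreviation tends :: "(nat \<Rightarrow> 'a mpser) \<Rightarrow> 'a mpser \<Rightarrow> bool" where
  "tends f L \<equiv> mps_tendsto (\<lambda>n. coeff (f n)) (coeff L)"

lemma mps_tendsto_unique:
  assumes "mps_tendsto S L" "mps_tendsto S L'"
  shows "L = L'"
proof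
  fix \<alpha>
  have "\<forall>\<^sub>F n in sequentially. S n \<alpha> = L \<alpha> \<and> S n \<alpha> = L' \<alpha>"
    using assms by (intro eventually_conj) (simp_all add: mps_tendsto_def)
  then obtain N where "\<forall>n\<ge>N. S n \<alpha> = L \<alpha> \<and> S n \<alpha> = L' \<alpha>"
    unfolding eventually_sequentially ..
  then show "L \<alpha> = L' \<alpha>"
    by auto
qed

lemma mps_lim_eqI: "mps_tendsto S L \<Longrightarrow> mps_lim S = L"
  unfolding mps_lim_def by (rule the_equality) (auto dest: mps_tendsto_unique)

lemma tends_unique: "tends f L \<Longrightarrow> tends f L' \<Longrightarrow> L = L'"
  using coeff_inject mps_tendsto_unique by blast

lemma tends_const [simp]: "tends (\<lambda>_. c) c"
  by (simp add: mps_tendsto_def)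

lemma tends_subseq:
  assumes "tends f L" "filterlim h sequentially sequentially"
  shows "tends (\<lambda>n. f (h n)) L"
  unfolding mps_tendsto_def
proof
  fix \<alpha>
  show "\<forall>\<^sub>F n in sequentially. coeff (f (h n)) \<alpha> = coeff L \<alpha>"
    by (rule eventually_compose_filterlim[OF _ assms(2), of "\<lambda>n. coeff (f n) \<alpha> = coeff L \<alpha>"])
      (use assms(1) in \<open>simp add: mps_tendsto_def\<close>)
qed

lemma tends_diff:
  assumes "tends f L" "tends g M"
  shows "tends (\<lambda>n. f n - g n) (L - M)"
  unfolding mps_tendsto_def
proof
  fix \<alpha>
  have "\<forall>\<^sub>F n in sequentially. coeff (f n) \<alpha> = coeff L \<alpha>"
    "\<forall>\<^sub>F n in sequentially. coeff (g n) \<alpha> = coeff M \<alpha>"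
    using assms by (auto simp: mps_tendsto_def)
  then show "\<forall>\<^sub>F n in sequentially. coeff (f n - g n) \<alpha> = coeff (L - M) \<alpha>"
    by eventually_elim simp
qed

lemma tends_mult:
  assumes "tends f L" "tends g M"
  shows "tends (\<lambda>n. f n * g n) (L * M)"
  unfolding mps_tendsto_def
proof
  fix \<alpha>
  have "\<forall>\<^sub>F n in sequentially. \<forall>p\<in>decomps \<alpha>.
      coeff (f n) (fst p) = coeff L (fst p) \<and> coeff (g n) (snd p) = coeff M (snd p)"
    using assms by (intro eventually_ball_finite finite_decomps ballI eventually_conj)
      (simp_all add: mps_tendsto_def)
  then show "\<forall>\<^sub>F n in sequentially. coeff (f n * g n) \<alpha> = coeff (L * M) \<alpha>"
    by eventually_elim (auto simp: coeff_mult intro!: sum.cong)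
qed

lemma tends_prod:
  "(\<And>i. i \<in> I \<Longrightarrow> tends (f i) (L i)) \<Longrightarrow> tends (\<lambda>n. \<Prod>i\<in>I. f i n) (\<Prod>i\<in>I. L i)"
  by (induction I rule: infinite_finite_induct) (simp_all add: tends_mult)

text \<open>The hypothesis says that every monomial of \<open>f i - 1\<close> contains Y_i. So a
  factor whose index lies beyond all variables of \<alpha> leaves the coefficient of \<alpha> in the
  product unchanged.\<close>

lemma tends_infinite_prod:
  fixes f :: "nat \<Rightarrow> 'a::comm_ring_1 mpser"
  assumes f: "\<And>i \<alpha>. Poly_Mapping.lookup \<alpha> i = 0 \<Longrightarrow> coeff (f i - 1) \<alpha> = 0"
  shows "\<exists>L. tends (\<lambda>N. \<Prod>i<N. f i) L"
proof -
  have "\<exists>c. \<forall>\<^sub>F N in sequentially. coeff (\<Prod>i<N. f i) \<alpha> = c" for \<alpha>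
  proof -
    obtain K where "\<forall>i\<in>Poly_Mapping.keys \<alpha>. i < K"
      using finite_keys[of \<alpha>] unfolding finite_nat_set_iff_bounded ..
    then have K: "Poly_Mapping.lookup \<alpha> i = 0" if "K \<le> i" for i
      using that by (meson in_keys_iff not_le)
    have step: "coeff (\<Prod>i<Suc N. f i) \<alpha> = coeff (\<Prod>i<N. f i) \<alpha>" if "K \<le> N" for N
    proof -
      have "coeff ((\<Prod>i<N. f i) * (f N - 1)) \<alpha> = 0"
      proof (rule ccontr)
        assume "coeff ((\<Prod>i<N. f i) * (f N - 1)) \<alpha> \<noteq> 0"
        then obtain \<beta> \<gamma> where "\<beta> + \<gamma> = \<alpha>" "coeff (f N - 1) \<gamma> \<noteq> 0"
          by (rule coeff_mult_nonzeroE)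
        then show False
          using f[of \<gamma> N] K[OF that] by (auto simp: lookup_add)
      qed
      moreover have "(\<Prod>i<Suc N. f i) = (\<Prod>i<N. f i) + (\<Prod>i<N. f i) * (f N - 1)"
        by (simp add: algebra_simps)
      ultimately show ?thesis
        by simp
    qed
    have "coeff (\<Prod>i<N. f i) \<alpha> = coeff (\<Prod>i<K. f i) \<alpha>" if "K \<le> N" for N
      using that by (induction rule: dec_induct) (use step in auto)
    then show ?thesis
      by (auto simp: eventually_sequentially)
  qed
  then obtain L where "\<And>\<alpha>. \<forall>\<^sub>F N in sequentially. coeff (\<Prod>i<N. f i) \<alpha> = L \<alpha>"
    by metis
  then have "tends (\<lambda>N. \<Prod>i<N. f i) (Mpser L)"
    by (simp add: mps_tendsto_def)
  then show ?thesis ..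
qed

section \<open>The infinite products H and E\<close>

lemma coeff_var_mult_eq_0:
  assumes "Poly_Mapping.lookup \<alpha> i = 0"
  shows "coeff (var c i * f) \<alpha> = 0"
proof (rule ccontr)
  assume "coeff (var c i * f) \<alpha> \<noteq> 0"
  then obtain \<beta> \<gamma> where "\<beta> + \<gamma> = \<alpha>" "coeff (var c i) \<beta> \<noteq> 0"
    by (rule coeff_mult_nonzeroE)
  then show False
    using assms by (auto simp: coeff_var lookup_add Yv_def split: if_splits)
qed

text \<open>\<open>H_ser\<close> is a definite description of a limit; only the convergence of the
  finite products gives access to it.\<close>

lemma tends_H_ser: "tends (\<lambda>N. \<Prod>i<N. geo (var a i)) (Mpser (H_ser a))"
proof -
  have "H_ser a = mps_lim (\<lambda>N. coeff (\<Prod>i<N. geo (var a i)))"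
  proof -
    have "mps_inverse (mps_diff (mps_const 1) (mps_monom a (Yv i))) = coeff (geo (var a i))" for i
      using mps_inverse_coeff[OF geo_inverse[OF homog_var[of a i]]]
      by (simp add: mps_diff_coeff[symmetric] mps_const_1 var_def)
    then show ?thesis
      by (simp add: H_ser_def mps_prod_coeff)
  qed
  moreover have "\<exists>L. tends (\<lambda>N. \<Prod>i<N. geo (var a i)) L"
  proof (rule tends_infinite_prod)
    fix i :: nat and \<alpha> assume "Poly_Mapping.lookup \<alpha> i = (0 :: nat)"
    then show "coeff (geo (var a i) - 1) \<alpha> = 0"
      by (subst geo_unfold) (simp_all add: coeff_var_mult_eq_0)
  qed
  ultimately show ?thesis
    by (metis coeff_Mpser mps_lim_eqI)
qed

lemma tends_E_ser: "tends (\<lambda>N. \<Prod>i<N. 1 - var a i) (Mpser (E_ser (- a)))"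
proof -
  have "E_ser (- a) = mps_lim (\<lambda>N. coeff (\<Prod>i<N. 1 - var a i))"
  proof -
    have "mps_add (mps_const 1) (mps_monom (- a) (Yv i)) = coeff (1 - var a i)" for i
      by (auto simp: fun_eq_iff mps_add_def mps_const_1 coeff_var mps_monom_def)
    then show ?thesis
      by (simp add: E_ser_def mps_prod_coeff)
  qed
  moreover have "\<exists>L. tends (\<lambda>N. \<Prod>i<N. 1 - var a i) L"
  proof (rule tends_infinite_prod)
    fix i :: nat and \<alpha> assume "Poly_Mapping.lookup \<alpha> i = (0 :: nat)"
    then show "coeff (1 - var a i - 1) \<alpha> = 0"
      using coeff_var_mult_eq_0[of \<alpha> i a 1] by simp
  qed
  ultimately show ?thesis
    by (metis coeff_Mpser mps_lim_eqI)
qed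

lemma E_ser_mult_H_ser: "Mpser (E_ser (- a)) * Mpser (H_ser a) = 1"
proof -
  have "(\<Prod>i<N. 1 - var a i) * (\<Prod>i<N. geo (var a i)) = 1" for N
    by (simp add: prod.distrib[symmetric] geo_inverse)
  then have "tends (\<lambda>_. 1) (Mpser (E_ser (- a)) * Mpser (H_ser a))"
    using tends_mult[OF tends_E_ser[of a] tends_H_ser[of a]] by simp
  then show ?thesis
    by (rule tends_unique) simp
qed

subsection \<open>Weights of words over a finite alphabet\<close>

text \<open>The decrease condition at the head of \<open>a # w\<close>: copies of a are skipped
  until a different letter decides. \<open>is_decrease_Cons_0\<close> links this recursion to the
  positional definition.\<close>

fun dec :: "nat \<Rightarrow> nat list \<Rightarrow> bool" where
  "dec a [] \<longleftrightarrow> False"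
| "dec a (b # w) \<longleftrightarrow> b < a \<or> b = a \<and> dec b w"

text \<open>\<open>M\<close> is the largest letter read so far, so that \<open>M \<le> a\<close> says that \<open>a\<close> is a record.\<close>

fun wgt :: "(nat \<Rightarrow> 'a) \<Rightarrow> (nat \<Rightarrow> 'a) \<Rightarrow> (nat \<Rightarrow> 'a) \<Rightarrow> nat \<Rightarrow> nat list \<Rightarrow> 'a::comm_ring_1" where
  "wgt x y z M [] = 1"
| "wgt x y z M (a # w) =
    (if dec a w then x a else if M \<le> a then z a else y a) * wgt x y z (max M a) w"

lemma dec_append_greater:
  "a < N \<Longrightarrow> set u \<subseteq> {..<N} \<Longrightarrow> dec a (u @ N # v) = dec a u"
  by (induction u arbitrary: a) auto

text \<open>For a smaller letter before N, the larger N acts like the end of the word in the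
  decrease test; after N the running maximum is N.\<close>

lemma wgt_append_max:
  "set u \<subseteq> {..<N} \<Longrightarrow> M \<le> N \<Longrightarrow>
    wgt x y z M (u @ N # v) = wgt x y z M u * wgt x y z N (N # v)"
  by (induction u arbitrary: M) (simp_all add: dec_append_greater mult.assoc max_def)

lemma dec_max: "set v \<subseteq> {..N} \<Longrightarrow> dec N v \<longleftrightarrow> v \<noteq> replicate (length v) N"
  by (induction v) auto

text \<open>Once N has been read, a smaller letter is no record, so z never enters. With z set to y,
  records no longer matter and M is arbitrary.\<close>

lemma wgt_below: "set u \<subseteq> {..<N} \<Longrightarrow> wgt x y z N u = wgt x y y M u"
  by (induction u arbitrary: M) (auto simp: max_def)

lemma not_dec_replicate: "\<not> dec a (replicate k a)"
  by (induction k) auto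

lemma wgt_replicate: "wgt x y z N (replicate k N) = z N ^ k"
  by (induction k) (simp_all add: not_dec_replicate)

section \<open>Cutting words at the maximal letter\<close>

lemma lists_Suc_decomp:
  "lists {..<Suc N} = lists {..<N} \<union>
    (\<lambda>(u, v). u @ N # v) ` (lists {..<N} \<times> lists {..<Suc N})" (is "_ = _ \<union> ?R")
proof
  show "lists {..<Suc N} \<subseteq> lists {..<N} \<union> ?R"
  proof
    fix w assume w: "w \<in> lists {..<Suc N}"
    show "w \<in> lists {..<N} \<union> ?R"
    proof (cases "N \<in> set w")
      case True
      \<comment> \<open>The cut is at the first N, which makes the decomposition unique.\<close>
      then obtain u v where uv: "w = u @ N # v" "N \<notin> set u"
        by (meson split_list_first)
      have "u \<in> lists {..<N}" "v \<in> lists {..<Suc N}"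
        using w uv by (auto simp: less_Suc_eq)
      then show ?thesis
        using uv(1) by (auto intro!: image_eqI[of _ _ "(u, v)"])
    next
      case False
      then show ?thesis
        using w by (auto simp: less_Suc_eq)
    qed
  qed
qed (auto simp: less_Suc_eq)

lemma inj_on_append_max:
  "inj_on (\<lambda>(u, v). u @ N # v) (lists {..<N} \<times> lists {..<Suc N})"
proof (rule inj_on_inverseI)
  fix p :: "nat list \<times> nat list"
  assume p: "p \<in> lists {..<N} \<times> lists {..<Suc N}"
  obtain u v where [simp]: "p = (u, v)"
    by (cases p)
  have "\<And>a. a \<in> set u \<Longrightarrow> a \<noteq> N"
    using p by auto
  then show "(\<lambda>w. (takeWhile (\<lambda>a. a \<noteq> N) w, tl (dropWhile (\<lambda>a. a \<noteq> N) w)))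
      (case p of (u, v) \<Rightarrow> u @ N # v) = p"
    by (simp add: takeWhile_append2 dropWhile_append2)
qed

text \<open>A finite alphabet has finitely many words of each length. The offset n allows for
  weights that carry further letters, as \<open>N # v\<close> does with n = 1.\<close>

lemma fsummable_lists:
  assumes "finite A" "\<And>w. homog (n + length w) (F w)"
  shows "fsummable F (lists A)"
proof (rule fsummable_homog)
  fix k
  have "finite {w. set w \<subseteq> A \<and> length w = k - n}"
    using assms(1) by (rule finite_lists_length_eq)
  then show "finite {w \<in> lists A. n + length w = k}"
    by (rule rev_finite_subset) auto
qed (rule assms(2))

locale letter_weights =
  fixes x y z :: "nat \<Rightarrow> 'a::comm_ring_1 mpser"
  assumes homog_x: "homog (Suc 0) (x a)"
    and homog_y: "homog (Suc 0) (y a)"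
    and homog_z: "homog (Suc 0) (z a)"
begin

lemma homog_wgt: "homog (length w) (wgt x y z M w)"
  by (induction w arbitrary: M)
    (auto intro: homog_mult[of "Suc 0", simplified] homog_x homog_y homog_z)

lemma fsummable_wgt: "finite A \<Longrightarrow> fsummable (wgt x y z M) (lists A)"
  by (rule fsummable_lists[of _ 0]) (simp_all add: homog_wgt)

lemma fsummable_wgt_Cons: "finite A \<Longrightarrow> fsummable (\<lambda>v. wgt x y z M (a # v)) (lists A)"
  using homog_wgt[of "a # v" M for v]
  by (intro fsummable_lists[of _ "Suc 0"]) (simp_all del: wgt.simps)

definition words :: "nat \<Rightarrow> nat \<Rightarrow> 'a mpser" where
  "words M N = msum (wgt x y z M) (lists {..<N})"

text \<open>Everything from the first N on; the summand 1 stands for words without N.\<close>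

definition tails :: "nat \<Rightarrow> 'a mpser" where
  "tails N = 1 + msum (\<lambda>v. wgt x y z N (N # v)) (lists {..<Suc N})"

lemma words_0: "words M 0 = 1"
  by (simp add: words_def)

text \<open>Cut at the first N: because M \<le> N, the running maximum becomes N there, so the
  weight of the tail depends neither on M nor on the letters before the cut.\<close>

lemma words_Suc:
  assumes "M \<le> N"
  shows "words M (Suc N) = words M N * tails N"
proof -
  let ?f = "\<lambda>(u, v). u @ N # v" and ?P = "lists {..<N} \<times> lists {..<Suc N}"
  have fs: "fsummable (wgt x y z M) (lists {..<N} \<union> ?f ` ?P)"
    unfolding lists_Suc_decomp[symmetric] by (simp add: fsummable_wgt)
  have "words M (Suc N) = msum (wgt x y z M) (lists {..<N} \<union> ?f ` ?P)"
    by (simp only: words_def lists_Suc_decomp[symmetric])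
  also have "\<dots> = words M N + msum (wgt x y z M) (?f ` ?P)"
    unfolding words_def by (rule msum_Un_disjoint[OF fs]) auto
  also have "msum (wgt x y z M) (?f ` ?P) =
      msum (\<lambda>(u, v). wgt x y z M u * wgt x y z N (N # v)) ?P"
    unfolding msum_reindex[OF inj_on_append_max]
  proof (rule msum_cong[OF refl])
    fix p assume "p \<in> ?P"
    then show "wgt x y z M (?f p) = (case p of (u, v) \<Rightarrow> wgt x y z M u * wgt x y z N (N # v))"
      using assms by (auto simp: split_def in_lists_conv_set simp del: wgt.simps
          intro!: wgt_append_max)
  qed
  also have "\<dots> = words M N * (tails N - 1)"
    by (simp add: words_def tails_def msum_mult fsummable_wgt fsummable_wgt_Cons del: wgt.simps)
  finally show ?thesis
    by (simp add: algebra_simps)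
qed

text \<open>A leading maximal letter \<open>N\<close> is an increase exactly in front of \<open>N \<dots> N\<close>; the second
  summand corrects the weight of those words.\<close>

lemma tails_eq: "tails N = 1 + x N * words N (Suc N) + (z N - x N) * geo (z N)"
proof -
  let ?c = "\<lambda>v. if dec N v then 0 else (z N - x N) * z N ^ length v"
  have dec: "dec N v \<longleftrightarrow> v \<noteq> replicate (length v) N" if "v \<in> lists {..<Suc N}" for v
    using that by (intro dec_max) (auto simp: in_lists_conv_set)
  have "msum (\<lambda>v. wgt x y z N (N # v)) (lists {..<Suc N}) =
      msum (\<lambda>v. x N * wgt x y z N v + ?c v) (lists {..<Suc N})"
  proof (rule msum_cong[OF refl])
    fix v assume v: "v \<in> lists {..<Suc N}"
    have "wgt x y z N v = z N ^ length v" if "\<not> dec N v"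
      using wgt_replicate[of x y z N "length v"] dec[OF v] that by simp
    then show "wgt x y z N (N # v) = x N * wgt x y z N v + ?c v"
      by (simp add: algebra_simps)
  qed
  also have "\<dots> = msum (\<lambda>v. x N * wgt x y z N v) (lists {..<Suc N}) + msum ?c (lists {..<Suc N})"
  proof (rule msum_add)
    show "fsummable (\<lambda>v. x N * wgt x y z N v) (lists {..<Suc N})"
      by (intro fsummable_lists[of _ "Suc 0"] homog_mult homog_x homog_wgt finite_lessThan)
    have "homog (Suc 0) (z N - x N)"
      by (intro homog_diff homog_z homog_x)
    then have "homog (Suc 0 + length v) (?c v)" for v
      by (simp add: homog_mult homog_power homog_z del: add_Suc)
    then show "fsummable ?c (lists {..<Suc N})"
      by (intro fsummable_lists[of _ "Suc 0"] finite_lessThan)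
  qed
  also have "msum (\<lambda>v. x N * wgt x y z N v) (lists {..<Suc N}) = x N * words N (Suc N)"
    by (simp add: words_def msum_const_mult fsummable_wgt)
  also have "msum ?c (lists {..<Suc N}) = msum ?c (range (\<lambda>k. replicate k N))"
  proof (rule msum_neutral)
    fix v assume v: "v \<in> lists {..<Suc N} - range (\<lambda>k. replicate k N)"
    then have "v \<noteq> replicate (length v) N"
      by (metis DiffD2 rangeI)
    then show "?c v = 0"
      using dec[of v] v by simp
  qed auto
  also have "\<dots> = msum (\<lambda>k. (z N - x N) * z N ^ k) UNIV"
    by (subst msum_reindex) (simp_all add: inj_on_def not_dec_replicate)
  also have "\<dots> = (z N - x N) * geo (z N)"
    by (simp add: geo_def msum_const_mult fsummable_power homog_z)
  finally show ?thesis
    by (simp add: tails_def)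
qed

text \<open>\<open>words_Suc\<close> with M = N writes the series on the right of
  \<open>tails_eq\<close> as B_N times \<open>tails N\<close>, where B_N = \<open>words N N\<close>
  by \<open>wgt_below\<close>. The equation becomes linear in \<open>tails N\<close>, and
  \<open>geo_unfold\<close> simplifies the rest.\<close>

lemma tails_mult:
  "tails N * (1 - x N * msum (wgt x y y 0) (lists {..<N})) = (1 - x N) * geo (z N)"
proof -
  have "words N N = msum (wgt x y y 0) (lists {..<N})"
    unfolding words_def by (rule msum_cong[OF refl]) (auto intro!: wgt_below)
  then have "tails N * (1 - x N * msum (wgt x y y 0) (lists {..<N})) =
      1 + (z N - x N) * geo (z N)"
    using tails_eq[of N] words_Suc[of N N] by (simp add: algebra_simps)
  also have "\<dots> = (1 - x N) * geo (z N)"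
    using geo_unfold[OF homog_z[of N]] by (simp add: algebra_simps)
  finally show ?thesis .
qed

end

text \<open>Let P_N be the product of the \<open>(1 - x b) * geo (y b)\<close> over b < N. By the
  recursion for B_N the quotient P_N / B_N starts at 1 and drops by x_N P_N at each step;
  \<open>denom\<close> is this quotient, written without division.\<close>

definition denom :: "(nat \<Rightarrow> 'a::comm_ring_1 mpser) \<Rightarrow> (nat \<Rightarrow> 'a mpser) \<Rightarrow> nat \<Rightarrow> 'a mpser" where
  "denom x y N = 1 - (\<Sum>a<N. x a * (\<Prod>b<a. (1 - x b) * geo (y b)))"

lemma denom_Suc: "denom x y (Suc N) = denom x y N - x N * (\<Prod>b<N. (1 - x b) * geo (y b))"
  by (simp add: denom_def)

text \<open>The case F_N = B_N comes first, because the general step needs the product of B_N and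
  \<open>denom\<close>.\<close>

lemma (in letter_weights) words_mult_denom_self:
  assumes "z = y"
  shows "words 0 N * denom x y N = (\<Prod>a<N. (1 - x a) * geo (y a))"
proof (induction N)
  case 0
  show ?case by (simp add: words_0 denom_def)
next
  case (Suc N)
  let ?B = "words 0 N"
  define P where "P = (\<Prod>a<N. (1 - x a) * geo (y a))"
  have IH: "?B * denom x y N = P"
    using Suc.IH by (simp add: P_def)
  have d: "denom x y (Suc N) = denom x y N - x N * P"
    by (simp only: denom_Suc P_def)
  have "words 0 (Suc N) * denom x y (Suc N) = tails N * (?B * denom x y N - x N * ?B * P)"
    unfolding d words_Suc[OF le0] by (simp add: algebra_simps)
  also have "\<dots> = tails N * (1 - x N * ?B) * P"
    unfolding IH by (simp add: algebra_simps)
  also have "tails N * (1 - x N * ?B) = (1 - x N) * geo (y N)"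
    unfolding words_def using tails_mult[of N] assms by simp
  finally show ?case
    by (simp add: P_def mult.commute)
qed

lemma (in letter_weights) words_mult_denom:
  "words 0 N * denom x y N = (\<Prod>a<N. (1 - x a) * geo (z a))"
proof (induction N)
  case 0
  show ?case by (simp add: words_0 denom_def)
next
  case (Suc N)
  interpret Y: letter_weights x y y
    by unfold_locales (rule homog_x homog_y)+
  let ?F = "words 0 N" and ?B = "Y.words 0 N"
  define Q where "Q = (\<Prod>a<N. (1 - x a) * geo (z a))"
  have IH: "?F * denom x y N = Q"
    using Suc.IH by (simp add: Q_def)
  \<comment> \<open>Writing P_N as B_N times \<open>denom\<close> brings out the factor 1 - x_N B_N,
    which \<open>tails_mult\<close> absorbs.\<close>
  have d: "denom x y (Suc N) = denom x y N - x N * (?B * denom x y N)"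
    by (simp only: denom_Suc Y.words_mult_denom_self[OF refl])
  have "words 0 (Suc N) * denom x y (Suc N) =
      tails N * (?F * denom x y N - x N * ?B * (?F * denom x y N))"
    unfolding d words_Suc[OF le0] by (simp add: algebra_simps)
  also have "\<dots> = tails N * (1 - x N * ?B) * Q"
    unfolding IH by (simp add: algebra_simps)
  also have "tails N * (1 - x N * ?B) = (1 - x N) * geo (z N)"
    using tails_mult[of N] by (simp add: Y.words_def)
  finally show ?case
    by (simp add: Q_def mult.commute)
qed

text \<open>Every letter of a word leaves a variable in each monomial of its weight. Q relates a
  letter to the index of that variable, so bounded indices will bound the letters.\<close>

lemma coeff_wgt_support:
  assumes "\<And>f b \<beta>. f \<in> {x, y, z} \<Longrightarrow> coeff (f b) \<beta> \<noteq> 0 \<Longrightarrow>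
    \<exists>i. Poly_Mapping.lookup \<beta> i \<noteq> 0 \<and> Q b i"
    and "coeff (wgt x y z M w) \<alpha> \<noteq> 0" "a \<in> set w"
  shows "\<exists>i. Poly_Mapping.lookup \<alpha> i \<noteq> 0 \<and> Q a i"
  using assms(2,3)
proof (induction w arbitrary: M \<alpha>)
  case (Cons b w)
  define f where "f = (if dec b w then x else if M \<le> b then z else y)"
  have f: "f \<in> {x, y, z}"
    by (simp add: f_def)
  have "wgt x y z M (b # w) = f b * wgt x y z (max M b) w"
    by (simp add: f_def)
  then have "coeff (f b * wgt x y z (max M b) w) \<alpha> \<noteq> 0"
    using Cons.prems(1) by simp
  then obtain \<beta> \<gamma> where \<beta>\<gamma>: "\<beta> + \<gamma> = \<alpha>" "coeff (f b) \<beta> \<noteq> 0"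
    "coeff (wgt x y z (max M b) w) \<gamma> \<noteq> 0"
    by (rule coeff_mult_nonzeroE)
  consider "a = b" | "a \<in> set w"
    using Cons.prems(2) by auto
  then obtain i where "Q a i" "Poly_Mapping.lookup \<beta> i \<noteq> 0 \<or> Poly_Mapping.lookup \<gamma> i \<noteq> 0"
    using assms(1)[OF f \<beta>\<gamma>(2)] Cons.IH[OF \<beta>\<gamma>(3)] by cases auto
  then show ?case
    using \<beta>\<gamma>(1) by (intro exI[of _ i]) (auto simp: lookup_add)
qed simp

lemma (in letter_weights) tends_words:
  assumes "\<And>\<alpha>. \<exists>K. \<forall>w. coeff (wgt x y z M w) \<alpha> \<noteq> 0 \<longrightarrow> w \<in> lists {..<K}"
  shows "tends (words M) (msum (wgt x y z M) UNIV)"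
  unfolding mps_tendsto_def
proof
  fix \<alpha>
  obtain K where K: "coeff (wgt x y z M w) \<alpha> \<noteq> 0 \<Longrightarrow> w \<in> lists {..<K}" for w
    using assms by blast
  have "coeff (words M N) \<alpha> = coeff (msum (wgt x y z M) UNIV) \<alpha>" if "K \<le> N" for N
  proof -
    have "lists {..<K} \<subseteq> lists {..<N}"
      using that by (intro lists_mono) auto
    then have "{w \<in> lists {..<N}. coeff (wgt x y z M w) \<alpha> \<noteq> 0} =
        {w \<in> UNIV. coeff (wgt x y z M w) \<alpha> \<noteq> 0}"
      using K by blast
    then show ?thesis
      by (simp only: words_def coeff_msum)
  qed
  then show "\<forall>\<^sub>F N in sequentially. coeff (words M N) \<alpha> = coeff (msum (wgt x y z M) UNIV) \<alpha>"
    by (auto simp: eventually_sequentially)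
qed

subsection \<open>The weights of the theorem\<close>

lemma is_decrease_Cons_Suc [simp]: "is_decrease (a # w) (Suc i) \<longleftrightarrow> is_decrease w i"
proof
  assume "is_decrease (a # w) (Suc i)"
  then obtain j where j: "Suc i \<le> j" "j + 1 < length (a # w)" "(a # w) ! j > (a # w) ! (j + 1)"
    "\<And>k. Suc i \<le> k \<Longrightarrow> k \<le> j \<Longrightarrow> (a # w) ! k = (a # w) ! Suc i"
    unfolding is_decrease_def by blast
  then obtain j' where j': "j = Suc j'"
    by (cases j) auto
  show "is_decrease w i"
    unfolding is_decrease_def
  proof (intro conjI exI[of _ j'] allI impI)
    show "w ! k = w ! i" if "i \<le> k \<and> k \<le> j'" for k
      using j(4)[of "Suc k"] j' that by simp
  qed (use j(1-3) j' in auto)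
next
  assume "is_decrease w i"
  then obtain j where j: "i \<le> j" "j + 1 < length w" "w ! j > w ! (j + 1)"
    "\<And>k. i \<le> k \<Longrightarrow> k \<le> j \<Longrightarrow> w ! k = w ! i"
    unfolding is_decrease_def by blast
  show "is_decrease (a # w) (Suc i)"
    unfolding is_decrease_def
  proof (intro conjI exI[of _ "Suc j"] allI impI)
    show "(a # w) ! k = (a # w) ! Suc i" if "Suc i \<le> k \<and> k \<le> Suc j" for k
      using j(4)[of "k - 1"] that by (cases k) simp_all
  qed (use j(1-3) in auto)
qed

text \<open>A witness j = 0 is an immediate drop; a witness j > 0 says that the next letter is a
  again and that j - 1 is a witness for the rest. This is the recursion of
  \<open>dec\<close>.\<close>

lemma is_decrease_Cons_0: "is_decrease (a # w) 0 \<longleftrightarrow> dec a w"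
proof (induction w arbitrary: a)
  case Nil
  show ?case by (simp add: is_decrease_def)
next
  case (Cons b w)
  have "is_decrease (a # b # w) 0 \<longleftrightarrow> b < a \<or> b = a \<and> is_decrease (b # w) 0"
  proof
    assume "is_decrease (a # b # w) 0"
    then obtain j where j: "j < Suc (length w)" "(a # b # w) ! j > (b # w) ! j"
      "\<forall>k\<le>j. (a # b # w) ! k = a"
      by (auto simp: is_decrease_def)
    show "b < a \<or> b = a \<and> is_decrease (b # w) 0"
    proof (cases j)
      case 0
      then show ?thesis using j(2) by simp
    next
      case (Suc j')
      have *: "(b # w) ! k = a" if "k \<le> j'" for k
        using j(3)[rule_format, of "Suc k"] Suc that by simp
      then have "b = a"
        using *[of 0] by simp
      then show ?thesis
        using * j(1,2) Suc by (auto simp: is_decrease_def intro!: exI[of _ j'])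
    qed
  next
    assume "b < a \<or> b = a \<and> is_decrease (b # w) 0"
    then show "is_decrease (a # b # w) 0"
    proof
      assume "b < a"
      then show ?thesis
        by (auto simp: is_decrease_def intro!: exI[of _ 0])
    next
      assume "b = a \<and> is_decrease (b # w) 0"
      then obtain j where j: "b = a" "j < length w" "(a # w) ! j > w ! j"
        "\<forall>k\<le>j. (a # w) ! k = a"
        by (auto simp: is_decrease_def)
      have "(a # a # w) ! k = a" if "k \<le> Suc j" for k
        using j(4)[rule_format, of "k - 1"] that by (cases k) simp_all
      then show ?thesis
        using j(1-3) by (auto simp: is_decrease_def intro!: exI[of _ "Suc j"])
    qed
  qed
  then show ?case
    by (simp add: Cons.IH)
qed

text \<open>Generalised over M because removing the first letter a leaves \<open>max M a\<close> as
  the bound that a record has to reach.\<close>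

lemma prod_eq_wgt:
  "(\<Prod>i<length w. if is_decrease w i then x (w ! i)
      else if M \<le> w ! i \<and> (\<forall>j<i. w ! j \<le> w ! i) then z (w ! i) else y (w ! i)) = wgt x y z M w"
proof (induction w arbitrary: M)
  case (Cons a w)
  let ?g = "\<lambda>M w i. if is_decrease w i then x (w ! i)
      else if M \<le> w ! i \<and> (\<forall>j<i. w ! j \<le> w ! i) then z (w ! i) else y (w ! i)"
  have "?g M (a # w) (Suc i) = ?g (max M a) w i" for i
    by (auto simp: All_less_Suc2)
  moreover have "?g M (a # w) 0 = (if dec a w then x a else if M \<le> a then z a else y a)"
    by (simp add: is_decrease_Cons_0)
  ultimately show ?case
    using Cons.IH[of "max M a"]
    by (simp only: length_Cons prod.lessThan_Suc_shift wgt.simps)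
qed simp

text \<open>The letter 0 is never a decrease, so its decrease weight is free; the value 0 makes
  the products below telescope.\<close>

definition xw :: "nat \<Rightarrow> 'a::comm_ring_1 \<Rightarrow> (nat \<Rightarrow> 'a) \<Rightarrow> nat \<Rightarrow> 'a mpser" where
  "xw l t s a = (if a = 0 then 0 else if a mod l = 0 then var t (a div l - 1)
     else var (s (a mod l)) (a div l))"

text \<open>With all \<open>rr\<close> equal to 1 the weights of case (c) become those of case (b),
  so this definition supplies both y and z.\<close>

definition zw :: "nat \<Rightarrow> (nat \<Rightarrow> 'a::comm_ring_1) \<Rightarrow> (nat \<Rightarrow> 'a) \<Rightarrow> nat \<Rightarrow> 'a mpser" where
  "zw l rr s a = (if a mod l = 0 then var (rr 0) (a div l)
     else var (rr (a mod l) * s (a mod l)) (a div l))"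

lemma letter_weights_xw_zw: "letter_weights (xw l t s) (zw l (\<lambda>_. 1) s) (zw l rr s)"
  by unfold_locales (simp_all add: xw_def zw_def)

lemma Psi_eq_wgt: "Psi l t rr s w = coeff (wgt (xw l t s) (zw l (\<lambda>_. 1) s) (zw l rr s) 0 w)"
proof -
  define g where "g i = (if is_decrease w i then xw l t s (w ! i)
      else if 0 \<le> w ! i \<and> (\<forall>j<i. w ! j \<le> w ! i) then zw l rr s (w ! i)
      else zw l (\<lambda>_. 1) s (w ! i))" for i
  have g: "wt l t rr s w i = coeff (g i)" if "i < length w" for i
  proof (cases "is_decrease w i")
    case True
    \<comment> \<open>The value of the letter occurs right before a drop, so it is positive; this
      excludes the special value of \<open>xw\<close> at 0.\<close>
    then obtain j where "w ! j = w ! i" "w ! j > w ! (j + 1)"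
      unfolding is_decrease_def by blast
    then have "w ! i \<noteq> 0"
      by simp
    with True show ?thesis
      by (simp add: wt_def Let_def g_def xw_def var_def)
  next
    case False
    with that show ?thesis
      by (cases "\<forall>j<i. w ! j \<le> w ! i")
        (simp_all add: wt_def Let_def g_def zw_def var_def is_record_def del: not_all)
  qed
  have "mps_prod (wt l t rr s w) n = coeff (\<Prod>i<n. g i)" if "n \<le> length w" for n
    using that by (induction n) (simp_all add: g mps_const_1 mps_mult_coeff)
  then have "Psi l t rr s w = coeff (\<Prod>i<length w. g i)"
    by (simp add: Psi_def)
  then show ?thesis
    by (simp only: g_def prod_eq_wgt)
qed

text \<open>A letter a contributes the variable with index \<open>a div l\<close>, or one less if it
  is a decrease divisible by l; \<open>Suc i\<close> allows for this shift. So the variables of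
  \<alpha> bound the letters.\<close>

lemma wgt_support_bounded:
  assumes "l > 0"
  shows "\<exists>K. \<forall>w. coeff (wgt (xw l t s) (zw l r s) (zw l rr s) M w) \<alpha> \<noteq> 0 \<longrightarrow> w \<in> lists {..<K}"
proof -
  obtain k where k: "\<forall>i\<in>Poly_Mapping.keys \<alpha>. i < k"
    using finite_keys[of \<alpha>] unfolding finite_nat_set_iff_bounded ..
  have "w \<in> lists {..<Suc k * l}"
    if "coeff (wgt (xw l t s) (zw l r s) (zw l rr s) M w) \<alpha> \<noteq> 0" for w
  proof (intro in_listsI ballI)
    fix a assume "a \<in> set w"
    have "\<exists>i. Poly_Mapping.lookup \<alpha> i \<noteq> 0 \<and> a div l \<le> Suc i"
      using _ that \<open>a \<in> set w\<close>
    proof (rule coeff_wgt_support)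
      fix f b \<beta>
      assume "f \<in> {xw l t s, zw l r s, zw l rr s}" "coeff (f b) \<beta> \<noteq> 0"
      then obtain i where "\<beta> = Yv i" "b div l \<le> Suc i"
        by (auto simp: xw_def zw_def coeff_var split: if_splits)
      then show "\<exists>i. Poly_Mapping.lookup \<beta> i \<noteq> 0 \<and> b div l \<le> Suc i"
        by (intro exI[of _ i]) (simp add: Yv_def)
    qed
    then obtain i where "i \<in> Poly_Mapping.keys \<alpha>" "a div l \<le> Suc i"
      by (auto simp: in_keys_iff)
    then have "a div l < Suc k"
      using k by fastforce
    then show "a \<in> {..<Suc k * l}"
      using assms by (simp add: div_less_iff_less_mult del: mult_Suc)
  qed
  then show ?thesis by blast
qed

subsection \<open>Closed forms for complete blocks of letters\<close>

lemma prod_lessThan_add: "(\<Prod>a<n + m. g a) = (\<Prod>a<n. g a) * (\<Prod>j<m. g (n + j :: nat))"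
  for g :: "nat \<Rightarrow> 'a::comm_monoid_mult"
  by (induction m) (simp_all add: mult.assoc)

lemma sum_lessThan_add: "(\<Sum>a<n + m. g a) = (\<Sum>a<n. g a) + (\<Sum>j<m. g (n + j :: nat))"
  for g :: "nat \<Rightarrow> 'a::comm_monoid_add"
  by (induction m) (simp_all add: add.assoc)

text \<open>\<open>pprod\<close> and \<open>hprod\<close> are E(-cY) and H(cY) truncated to the
  variables Y_i with i < U.\<close>

abbreviation pprod :: "'a::comm_ring_1 \<Rightarrow> nat \<Rightarrow> 'a mpser" where
  "pprod c U \<equiv> \<Prod>i<U. 1 - var c i"

abbreviation hprod :: "'a::comm_ring_1 \<Rightarrow> nat \<Rightarrow> 'a mpser" where
  "hprod c U \<equiv> \<Prod>i<U. geo (var c i)"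

lemma xw_block:
  assumes "l = Suc k"
  shows "xw l t s (U * l) = (if U = 0 then 0 else var t (U - 1))"
    and "j < k \<Longrightarrow> xw l t s (U * l + Suc j) = var (s (Suc j)) U"
    and "zw l rr s (U * l) = var (rr 0) U"
    and "j < k \<Longrightarrow> zw l rr s (U * l + Suc j) = var (rr (Suc j) * s (Suc j)) U"
proof -
  have *: "(U * l + Suc j) div l = U" "(U * l + Suc j) mod l = Suc j" if "j < k"
    unfolding add.commute[of "U * l"] mod_mult_self1
    by (subst div_mult_self1) (use that assms in simp_all)
  show "xw l t s (U * l) = (if U = 0 then 0 else var t (U - 1))" "zw l rr s (U * l) = var (rr 0) U"
    using assms by (simp_all add: xw_def zw_def del: mult_Suc_right)
  show "xw l t s (U * l + Suc j) = var (s (Suc j)) U"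
    "zw l rr s (U * l + Suc j) = var (rr (Suc j) * s (Suc j)) U" if "j < k"
    using *[OF that] by (simp_all add: xw_def zw_def del: add_Suc_right)
qed

text \<open>At U = 0 the truncated difference U - 1 and the value 0 of \<open>xw\<close> at the
  letter 0 fit together: both sides are 1.\<close>

lemma pprod_block: "pprod t (U - 1) * (1 - (if U = 0 then 0 else var t (U - 1))) = pprod t U"
  by (cases U) auto

text \<open>The letters from U l to U l + l - 1 form block U and carry Y_U, except that the decrease
  weight of U l carries Y_(U-1). Hence the product for t lags one factor behind.\<close>

lemma prod_xw_zw:
  assumes l: "l = Suc k"
  shows "(\<Prod>a<U * l. (1 - xw l t s a) * geo (zw l rr s a)) =
    pprod t (U - 1) * hprod (rr 0) U *
      (\<Prod>j<k. pprod (s (Suc j)) U * hprod (rr (Suc j) * s (Suc j)) U)"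
proof (induction U)
  case (Suc U)
  let ?g = "\<lambda>a. (1 - xw l t s a) * geo (zw l rr s a)"
  let ?R = "\<lambda>U. \<Prod>j<k. pprod (s (Suc j)) U * hprod (rr (Suc j) * s (Suc j)) U"
  have "(\<Prod>a<Suc U * l. ?g a) = (\<Prod>a<U * l. ?g a) * (\<Prod>j<l. ?g (U * l + j))"
    by (simp only: mult_Suc add.commute[of l] prod_lessThan_add)
  also have "(\<Prod>j<l. ?g (U * l + j)) = ?g (U * l) * (\<Prod>j<k. ?g (U * l + Suc j))"
    unfolding l prod.lessThan_Suc_shift by simp
  also have "(\<Prod>j<k. ?g (U * l + Suc j)) =
      (\<Prod>j<k. (1 - var (s (Suc j)) U) * geo (var (rr (Suc j) * s (Suc j)) U))"
    by (intro prod.cong) (simp_all add: xw_block[OF l] del: add_Suc_right)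
  also have "(\<Prod>a<U * l. ?g a) * (?g (U * l) * \<dots>) =
      pprod t (U - 1) * (1 - (if U = 0 then 0 else var t (U - 1))) *
      (hprod (rr 0) U * geo (var (rr 0) U)) * (?R U * \<dots>)"
    unfolding Suc.IH xw_block(1,3)[OF l] by (simp only: ac_simps)
  also have "\<dots> = pprod t (Suc U - 1) * hprod (rr 0) (Suc U) * ?R (Suc U)"
    unfolding pprod_block by (simp add: prod.distrib[symmetric] ac_simps)
  finally show ?case .
qed simp

lemma pprod_mult_hprod: "pprod c U * hprod c U = 1"
  by (simp add: prod.distrib[symmetric] geo_inverse)

lemma prod_xw_zw_1:
  assumes l: "l = Suc k"
  shows "(\<Prod>a<U * l. (1 - xw l t s a) * geo (zw l (\<lambda>_. 1) s a)) = pprod t (U - 1) * hprod 1 U"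
  unfolding prod_xw_zw[OF l] by (simp add: pprod_mult_hprod)

text \<open>With all r_m = 1, the letters U l + m with 1 \<le> m < l have equal decrease and
  increase weights. Their factors are 1, so the product stays constant through the block after its
  first letter.\<close>

lemma prod_xw_zw_1_partial:
  assumes l: "l = Suc k" and "j \<le> k"
  shows "(\<Prod>a<U * l + Suc j. (1 - xw l t s a) * geo (zw l (\<lambda>_. 1) s a)) = pprod t U * hprod 1 (Suc U)"
proof -
  let ?g = "\<lambda>a. (1 - xw l t s a) * geo (zw l (\<lambda>_. 1) s a)"
  have "(\<Prod>i<j. ?g (U * l + Suc i)) = (\<Prod>i<j. 1)"
    using assms(2) by (intro prod.cong) (simp_all add: xw_block[OF l] geo_inverse del: add_Suc_right)
  then have "(\<Prod>a<U * l + Suc j. ?g a) = (\<Prod>a<U * l. ?g a) * ?g (U * l)"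
    unfolding prod_lessThan_add prod.lessThan_Suc_shift by simp
  also have "\<dots> = pprod t (U - 1) * (1 - (if U = 0 then 0 else var t (U - 1))) *
      (hprod 1 U * geo (var 1 U))"
    unfolding prod_xw_zw_1[OF l] xw_block(1,3)[OF l] by (simp only: ac_simps)
  finally show ?thesis
    unfolding pprod_block by simp
qed

text \<open>Over the common factor \<open>pprod t U * hprod 1 (Suc U)\<close> the difference is (1 -
  t Y_U) - (1 - Y_U).\<close>

lemma telescope:
  fixes t :: "'a::comm_ring_1"
  shows "const (1 - t) * var 1 U * (pprod t U * hprod 1 (Suc U)) =
    pprod t (Suc U) * hprod 1 (Suc U) - pprod t U * hprod 1 U"
proof -
  define p h g v where "p = pprod t U" "h = hprod (1 :: 'a) U" "g = geo (var (1 :: 'a) U)"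
    "v = var (1 :: 'a) U"
  have "g = 1 + v * g"
    unfolding p_h_g_v_def by (rule geo_unfold) simp
  then have "h * g = h * (1 + v * g)"
    by (rule arg_cong)
  then have "h = h * g - h * v * g"
    by (simp add: algebra_simps)
  have "pprod t (Suc U) * hprod 1 (Suc U) - pprod t U * hprod 1 U =
      p * (1 - const t * v) * (h * g) - p * h"
    by (simp add: p_h_g_v_def var_eq_const_mult[of t])
  also have "\<dots> = p * (1 - const t * v) * (h * g) - p * (h * g - h * v * g)"
    using \<open>h = h * g - h * v * g\<close> by simp
  also have "\<dots> = const (1 - t) * v * (p * (h * g))"
    by (simp add: const_diff algebra_simps)
  finally show ?thesis
    by (simp add: p_h_g_v_def)
qed

text \<open>Block U adds to the sum in \<open>denom\<close> the terms s_m Y_U times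
  \<open>pprod t U * hprod 1 (Suc U)\<close> and, for U > 0, a term with t Y_(U-1) of the same shape
  one index lower. After multiplication by 1 - t both kinds telescope.\<close>

lemma denom_block:
  fixes t :: "'a::comm_ring_1" and s :: "nat \<Rightarrow> 'a"
  assumes l: "l = Suc k"
  defines "S \<equiv> const (\<Sum>j<k. s (Suc j))"
  shows "const (1 - t) * denom (xw l t s) (zw l (\<lambda>_. 1) s) (U * l) =
    1 + S - S * (pprod t U * hprod 1 U) - const t * (pprod t (U - 1) * hprod 1 (U - 1))"
proof (induction U)
  case 0
  show ?case by (simp add: denom_def const_diff)
next
  case (Suc U)
  let ?P = "\<lambda>a. \<Prod>b<a. (1 - xw l t s b) * geo (zw l (\<lambda>_. 1) s b)"
  let ?g = "\<lambda>a. xw l t s a * ?P a"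
  let ?q = "\<lambda>U. pprod t U * hprod 1 U"
  let ?d = "denom (xw l t s) (zw l (\<lambda>_. 1) s)"
  have "(\<Sum>a<Suc U * l. ?g a) = (\<Sum>a<U * l. ?g a) + (\<Sum>j<l. ?g (U * l + j))"
    by (simp only: mult_Suc add.commute[of l] sum_lessThan_add)
  also have "(\<Sum>j<l. ?g (U * l + j)) = ?g (U * l) + (\<Sum>j<k. ?g (U * l + Suc j))"
    unfolding l sum.lessThan_Suc_shift by simp
  also have "(\<Sum>j<k. ?g (U * l + Suc j)) =
      (\<Sum>j<k. const (s (Suc j)) * (var 1 U * (pprod t U * hprod 1 (Suc U))))"
  proof (intro sum.cong refl)
    fix j assume "j \<in> {..<k}"
    then have "j < k" "j \<le> k" by auto
    then show "?g (U * l + Suc j) =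
        const (s (Suc j)) * (var 1 U * (pprod t U * hprod 1 (Suc U)))"
      unfolding prod_xw_zw_1_partial[OF l \<open>j \<le> k\<close>] xw_block(2)[OF l \<open>j < k\<close>]
        var_eq_const_mult[of "s (Suc j)"] by (simp only: mult.assoc)
  qed
  also have "\<dots> = S * (var 1 U * (pprod t U * hprod 1 (Suc U)))"
    by (simp only: S_def const_sum sum_distrib_right)
  finally have d: "?d (Suc U * l) =
      ?d (U * l) - ?g (U * l) - S * (var 1 U * (pprod t U * hprod 1 (Suc U)))"
    by (simp only: denom_def diff_diff_eq add.assoc)
  \<comment> \<open>For U > 0 this is \<open>telescope\<close> at U - 1; for U = 0 both sides
    vanish, the right one because U - 1 = U.\<close>
  have g: "const (1 - t) * ?g (U * l) = const t * (?q U - ?q (U - 1))"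
  proof (cases U)
    case 0
    then show ?thesis by (simp add: xw_def)
  next
    case (Suc V)
    have "?g (U * l) = const t * (var 1 V * (pprod t V * hprod 1 (Suc V)))"
      unfolding prod_xw_zw_1[OF l] xw_block(1)[OF l] using Suc
      by (simp add: var_eq_const_mult[of t] mult.assoc)
    then have "const (1 - t) * ?g (U * l) =
        const t * (const (1 - t) * var 1 V * (pprod t V * hprod 1 (Suc V)))"
      by (simp only: ac_simps)
    then show ?thesis
      unfolding telescope using Suc by simp
  qed
  have "const (1 - t) * ?d (Suc U * l) = const (1 - t) * ?d (U * l) - const (1 - t) * ?g (U * l)
      - S * (const (1 - t) * var 1 U * (pprod t U * hprod 1 (Suc U)))"
    unfolding d by (simp only: right_diff_distrib ac_simps)
  also have "\<dots> = 1 + S - S * ?q (Suc U) - const t * ?q U"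
    unfolding Suc.IH g telescope by (simp only: algebra_simps)
  finally show ?case
    by simp
qed

section \<open>The limit over all blocks and the final formula\<close>

abbreviation Hs :: "'a::comm_ring_1 \<Rightarrow> 'a mpser" where
  "Hs c \<equiv> Mpser (H_ser c)"

abbreviation Es :: "'a::comm_ring_1 \<Rightarrow> 'a mpser" where
  "Es c \<equiv> Mpser (E_ser c)"

text \<open>Take N = (U + 1) l in \<open>words_mult_denom\<close>, multiply by 1 - t, insert the
  closed forms and let U tend to infinity. The identity is free of division, since it serves to
  prove that the denominator is invertible.\<close>

lemma word_series_identity:
  fixes t :: "'a::comm_ring_1" and s rr :: "nat \<Rightarrow> 'a"
  assumes l: "l = Suc k"
  defines "S \<equiv> \<Sum>j<k. s (Suc j)"
  defines "W \<equiv> msum (wgt (xw l t s) (zw l (\<lambda>_. 1) s) (zw l rr s) 0) UNIV"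
  shows "W * (const (1 + S) * Hs t - const (t + S) * Hs 1) =
    const (1 - t) * Hs (rr 0) * (\<Prod>j<k. Es (- s (Suc j)) * Hs (rr (Suc j) * s (Suc j)))"
proof -
  interpret letter_weights "xw l t s" "zw l (\<lambda>_. 1) s" "zw l rr s"
    by (rule letter_weights_xw_zw)
  let ?R = "\<lambda>U. \<Prod>j<k. pprod (s (Suc j)) U * hprod (rr (Suc j) * s (Suc j)) U"
  let ?R' = "\<Prod>j<k. Es (- s (Suc j)) * Hs (rr (Suc j) * s (Suc j))"
  \<comment> \<open>Starting at \<open>Suc U\<close> turns the index U - 1 of the closed forms into
    U.\<close>
  let ?w = "\<lambda>U. words 0 (Suc U * l)"
  have "filterlim (\<lambda>U. Suc U * l) sequentially sequentially"
    unfolding filterlim_at_top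
  proof
    fix Z
    show "\<forall>\<^sub>F U in sequentially. Z \<le> Suc U * l"
      by (rule eventually_sequentiallyI[of Z]) (simp add: l)
  qed
  moreover have "tends (words 0) W"
    unfolding W_def by (rule tends_words[OF wgt_support_bounded]) (simp add: l)
  ultimately have w: "tends ?w W"
    by (rule tends_subseq[rotated])
  have Suc: "tends (\<lambda>U. f (Suc U)) L" if "tends f L" for f and L :: "'a mpser"
    by (rule tends_subseq[OF that filterlim_Suc])
  have "?w U * (const (1 - t) * denom (xw l t s) (zw l (\<lambda>_. 1) s) (Suc U * l)) =
      const (1 - t) * (pprod t U * hprod (rr 0) (Suc U) * ?R (Suc U))" for U
    using words_mult_denom[of "Suc U * l"] unfolding prod_xw_zw[OF l]
    by (simp only: diff_Suc_1 mult.left_commute[of _ "const (1 - t)"])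
  then have eq: "?w U * (const (1 + S) - const S * (pprod t (Suc U) * hprod 1 (Suc U))
        - const t * (pprod t U * hprod 1 U)) =
      const (1 - t) * (pprod t U * hprod (rr 0) (Suc U) * ?R (Suc U))" for U
    unfolding denom_block[OF l] S_def by (simp only: diff_Suc_1 const_add const_1)
  have "tends (\<lambda>U. ?w U * (const (1 + S) - const S * (pprod t (Suc U) * hprod 1 (Suc U))
        - const t * (pprod t U * hprod 1 U)))
      (W * (const (1 + S) - const S * (Es (- t) * Hs 1) - const t * (Es (- t) * Hs 1)))"
    by (intro tends_mult tends_diff w tends_const tends_E_ser tends_H_ser
        Suc[OF tends_E_ser] Suc[OF tends_H_ser])
  moreover have "tends (\<lambda>U. const (1 - t) * (pprod t U * hprod (rr 0) (Suc U) * ?R (Suc U)))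
      (const (1 - t) * (Es (- t) * Hs (rr 0) * ?R'))"
    by (intro tends_mult tends_const tends_prod tends_E_ser
        Suc[OF tends_E_ser] Suc[OF tends_H_ser])
  ultimately have lim: "W * (const (1 + S) - const S * (Es (- t) * Hs 1) - const t * (Es (- t) * Hs 1)) =
      const (1 - t) * (Es (- t) * Hs (rr 0) * ?R')"
    unfolding eq by (rule tends_unique)
  have EH: "Es (- t) * Hs t = 1"
    by (rule E_ser_mult_H_ser)
  \<comment> \<open>Multiplying by H(tY), the inverse of E(-tY), clears E(-tY) on both
    sides.\<close>
  have "W * (const (1 + S) * Hs t - const (t + S) * Hs 1) =
      W * (const (1 + S) * Hs t - (const S + const t) * Hs 1 * (Es (- t) * Hs t))"
    by (simp add: EH const_add add.commute)
  also have "\<dots> = W * (const (1 + S) - const S * (Es (- t) * Hs 1) - const t * (Es (- t) * Hs 1)) * Hs t"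
    by (simp add: algebra_simps)
  also have "\<dots> = const (1 - t) * Hs (rr 0) * ?R' * (Es (- t) * Hs t)"
    unfolding lim by (simp only: ac_simps)
  finally show ?thesis
    by (simp add: EH)
qed

theorem theorem3p4:
  fixes l :: nat and t :: "'a::field" and rr s :: "nat \<Rightarrow> 'a"
  assumes "l \<ge> 1" and "t \<noteq> 1"
  shows "mps_tendsto
     (\<lambda>N. mps_sum (Psi l t rr s) {w. set w \<subseteq> {0..N}})
     (mps_divide
        (mps_mult (mps_scale (1 - t) (H_ser (rr 0)))
           (mps_prod (\<lambda>i. mps_mult (E_ser (- s (i + 1))) (H_ser (rr (i + 1) * s (i + 1)))) (l - 1)))
        (mps_diff
           (mps_scale (1 + (\<Sum>m=1..l-1. s m)) (H_ser t))
           (mps_scale (t + (\<Sum>m=1..l-1. s m)) (H_ser 1))))"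
proof -
  obtain k where l: "l = Suc k"
    using assms(1) by (cases l) auto
  define S where "S = (\<Sum>j<k. s (Suc j))"
  \<comment> \<open>A function of \<open>rr\<close>, because the identity is used for the given
    \<open>rr\<close> and for the constant 1, with the same denominator \<open>D\<close>.\<close>
  define W where "W rr = msum (wgt (xw l t s) (zw l (\<lambda>_. 1) s) (zw l rr s) 0) UNIV" for rr
  define D where "D = const (1 + S) * Hs t - const (t + S) * Hs 1"
  define R where "R rr = (\<Prod>j<k. Es (- s (Suc j)) * Hs (rr (Suc j) * s (Suc j)))" for rr
  have W: "W rr * D = const (1 - t) * Hs (rr 0) * R rr" for rr
    unfolding W_def D_def S_def R_def by (rule word_series_identity[OF l])
  have c: "const (1 - t) * const (1 / (1 - t)) = 1"
    using assms(2) by (simp add: const_mult[symmetric])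
  have W1: "W (\<lambda>_. 1) * D = const (1 - t) * Hs 1"
    unfolding W by (simp add: R_def E_ser_mult_H_ser)
  \<comment> \<open>In \<open>W1\<close> the factors 1 - t and H(Y) are invertible, with inverses 1
    / (1 - t) and E(-Y); this exhibits an inverse of \<open>D\<close>, which gives
    \<open>mps_divide\<close> its value.\<close>
  define I where "I = W (\<lambda>_. 1) * (const (1 / (1 - t)) * Es (- 1))"
  have "D * I = (W (\<lambda>_. 1) * D) * (const (1 / (1 - t)) * Es (- 1))"
    by (simp only: I_def ac_simps)
  also have "\<dots> = const (1 - t) * const (1 / (1 - t)) * (Es (- 1) * Hs 1)"
    unfolding W1 by (simp only: ac_simps)
  finally have I: "D * I = 1"
    by (simp only: c E_ser_mult_H_ser mult_1)
  have "S = (\<Sum>m=1..l-1. s m)"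
    by (simp add: S_def l sum.atLeast1_atMost_eq)
  then have "coeff D = mps_diff (mps_scale (1 + (\<Sum>m=1..l-1. s m)) (H_ser t))
      (mps_scale (t + (\<Sum>m=1..l-1. s m)) (H_ser 1))"
    by (simp add: D_def mps_diff_coeff[symmetric] coeff_scale[symmetric])
  moreover have "coeff (const (1 - t) * Hs (rr 0) * R rr) =
      mps_mult (mps_scale (1 - t) (H_ser (rr 0)))
        (mps_prod (\<lambda>i. mps_mult (E_ser (- s (i + 1))) (H_ser (rr (i + 1) * s (i + 1)))) (l - 1))"
    using coeff_scale[of "1 - t" "Hs (rr 0)"]
    by (simp add: l R_def mps_mult_coeff[symmetric] mps_prod_coeff[symmetric])
  moreover have "mps_divide (coeff (const (1 - t) * Hs (rr 0) * R rr)) (coeff D) = coeff (W rr)"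
    unfolding mps_divide_def mps_inverse_coeff[OF I] mps_mult_coeff W[symmetric]
    by (simp add: mult.assoc I)
  moreover have "mps_tendsto (\<lambda>N. mps_sum (Psi l t rr s) {w. set w \<subseteq> {0..N}}) (coeff (W rr))"
  proof -
    interpret letter_weights "xw l t s" "zw l (\<lambda>_. 1) s" "zw l rr s"
      by (rule letter_weights_xw_zw)
    have "{w. set w \<subseteq> {0..N}} = lists {..<Suc N}" for N
      by (auto simp: less_Suc_eq_le)
    then have "mps_sum (Psi l t rr s) {w. set w \<subseteq> {0..N}} = coeff (words 0 (Suc N))" for N
      by (simp add: words_def msum_def Psi_eq_wgt[abs_def] del: lists_eq_set)
    moreover have "tends (words 0) (W rr)"
      unfolding W_def by (rule tends_words[OF wgt_support_bounded]) (simp add: l)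
    ultimately show ?thesis
      using tends_subseq[OF _ filterlim_Suc] by simp
  qed
  ultimately show ?thesis
    by simp
qed

end
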